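(* Let $q$ be a prime power with $q\equiv -1 \pmod 4$, and put $v=1+q+q^2+q^3$. Then there is a quasi-balanced weighing matrix $W$ of order $v$ and weight $q+q^2$ such that $|W|$ is the adjacency matrix of a strongly regular graph with parameters $(1+q+q^2+q^3,\;q+q^2,\;q-1,\;q+1)$. Furthermore, the complete graph $K_v$ decomposes into $1+q$ Siamese signed strongly regular graphs with these same parameters sharing $1+q^2$ cliques of size $1+q$; that is, there are quasi-balanced weighing matrices $W_0,\dots,W_q$ of order $v$ and weight $q+q^2$ and a graph $F$ on the vertex set of $K_v$, with $F$ a disjoint union of $1+q^2$ cliques of size $1+q$, such that each $|W_\ell|$ is the adjacency matrix of a strongly regular graph $\Gamma_\ell$ with parameters $(1+q+q^2+q^3,\;q+q^2,\;q-1,\;q+1)$, every edge of $F$ belongs to all of $\Gamma_0,\dots,\Gamma_q$, and every edge of $K_v$ not in $F$ belongs to exactly one of $\Gamma_0,\dots,\Gamma_q$.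
   Context: A weighing matrix of order $v$ and weight $k$ is a $v\times v$ matrix $W$ with entries in $\{0,1,-1\}$ satisfying $WW^\top=kI_v$. For a matrix $W$, $|W|$ denotes the entrywise absolute value, $|W|_{ij}=|W_{ij}|$. A weighing matrix $W$ is quasi-balanced if $|W|\,|W|^\top=|W|^\top|W|$ and the off-diagonal entries of $|W|\,|W|^\top$ take at most two distinct values. A graph (simple, undirected) on $v$ vertices with adjacency matrix $A$ is strongly regular with parameters $(v,k,\lambda,\mu)$ if $A^2=kI_v+\lambda A+\mu(J_v-I_v-A)$, where $J_v$ is the all-ones matrix. A strongly regular graph with adjacency matrix $A$ is signed by $W$ if $W$ is a quasi-balanced weighing matrix with $|W|=A$. *)

theory Defs
  imports
    "Jordan_Normal_Form.Matrix"
    "HOL-Library.Disjoint_Sets"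
    "HOL-Number_Theory.Number_Theory"
begin

definition abs_mat :: "int mat \<Rightarrow> int mat" where
  "abs_mat W = map_mat abs W"

definition all_ones_mat :: "nat \<Rightarrow> int mat" where
  "all_ones_mat v = mat v v (\<lambda>_. 1)"

definition weighing_matrix :: "nat \<Rightarrow> nat \<Rightarrow> int mat \<Rightarrow> bool" where
  "weighing_matrix v k W \<longleftrightarrow>
     W \<in> carrier_mat v v \<and>
     elements_mat W \<subseteq> {0, 1, -1} \<and>
     W * transpose_mat W = int k \<cdot>\<^sub>m 1\<^sub>m v"

definition off_diagonal_entries :: "'a mat \<Rightarrow> 'a set" where
  "off_diagonal_entries M =
     {M $$ (i, j) | i j. i < dim_row M \<and> j < dim_col M \<and> i \<noteq> j}"

text \<open>The set of off-diagonal entries of a matrix is finite, so \<open>card\<close> is meaningful here.\<close>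

definition quasi_balanced_weighing_matrix :: "nat \<Rightarrow> nat \<Rightarrow> int mat \<Rightarrow> bool" where
  "quasi_balanced_weighing_matrix v k W \<longleftrightarrow>
     weighing_matrix v k W \<and>
     abs_mat W * transpose_mat (abs_mat W) = transpose_mat (abs_mat W) * abs_mat W \<and>
     card (off_diagonal_entries (abs_mat W * transpose_mat (abs_mat W))) \<le> 2"

text \<open>A simple undirected graph on the vertex set \<open>{..<v}\<close> is given by its edge set,
  a set of two-element subsets of \<open>{..<v}\<close>.\<close>

definition complete_graph :: "nat set \<Rightarrow> nat set set" where
  "complete_graph V = {e. e \<subseteq> V \<and> card e = 2}"

definition simple_graph :: "nat \<Rightarrow> nat set set \<Rightarrow> bool" where
  "simple_graph v E \<longleftrightarrow> E \<subseteq> complete_graph {..<v}"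

text \<open>The diagonal vanishes for simple graphs, because \<open>{i, i}\<close> is a singleton.\<close>

definition adjacency_matrix :: "nat \<Rightarrow> nat set set \<Rightarrow> int mat" where
  "adjacency_matrix v E = mat v v (\<lambda>(i, j). if {i, j} \<in> E then 1 else 0)"

definition strongly_regular_graph ::
    "nat \<Rightarrow> nat \<Rightarrow> nat \<Rightarrow> nat \<Rightarrow> nat set set \<Rightarrow> bool" where
  "strongly_regular_graph v k l m E \<longleftrightarrow>
     simple_graph v E \<and>
     (let A = adjacency_matrix v E in
        A * A = int k \<cdot>\<^sub>m 1\<^sub>m v + int l \<cdot>\<^sub>m A + int m \<cdot>\<^sub>m (all_ones_mat v - 1\<^sub>m v - A))"

definition disjoint_union_of_cliques :: "nat \<Rightarrow> nat \<Rightarrow> nat \<Rightarrow> nat set set \<Rightarrow> bool" where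
  "disjoint_union_of_cliques v c s F \<longleftrightarrow>
     (\<exists>P. partition_on {..<v} P \<and> card P = c \<and> (\<forall>C\<in>P. card C = s) \<and>
          F = (\<Union>C\<in>P. complete_graph C))"

end

(*
  Let F be the field with q elements. As q = 3 mod 4, -1 is a non-square in F and K = F(i) is the
  field with q^2 elements. The vertices are the points of PG(3,q), seen as F-lines in K^2. Let
  omega be the determinant form on K^2. For c in K^*/F^*, which has q + 1 elements, im (c omega)
  is a symplectic form over F, so its collinearity graph (that of the generalised quadrangle W(q))
  is strongly regular. All these forms vanish on the K-lines, which are the common cliques, and for
  w = omega(x,y) nonzero exactly one class c satisfies im (c w) = 0: this gives the decomposition.

  The signs come from the quadratic character eta of F, which is odd: eta (im (y/x)) if x and y
  span the same K-line, and eta (c omega(x,y)) otherwise, where c omega(x,y) lies in F. Rows x and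
  y on the same K-line are orthogonal because eta sums to 0 along affine lines; for different
  K-lines one writes z = a x + b y with a, b in K and uses that eta is odd.
*)
theory Submission
  imports Defs
    "HOL-Library.Product_Plus"
    "HOL-Algebra.Algebraic_Closure_Type"
    "Berlekamp_Zassenhaus.Finite_Field"
begin

hide_const (open) Divisibility.prime

section \<open>Finite fields of order 3 modulo 4 and their quadratic character\<close>

text \<open>A class rather than a locale, so that the quadratic extension can be a type constructor
  over any such field and \<open>CARD('a)\<close> can stand for q.\<close>

class paley_field = finite_field +
  assumes card_mod_4: "card (UNIV :: 'a set) mod 4 = 3"

lemma odd_card_paley_field: "odd CARD('a :: paley_field)"
  using card_mod_4[where ?'a = 'a] by presburger

lemma odd_half_card_paley_field: "odd ((CARD('a :: paley_field) - 1) div 2)"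
  using card_mod_4[where ?'a = 'a] by presburger

lemma card_paley_field_gt_1: "CARD('a :: paley_field) > 1"
  using card_mod_4[where ?'a = 'a] by presburger

lemma one_neq_minus_one_paley_field: "(1 :: 'a :: paley_field) \<noteq> - 1"
proof
  assume "(1 :: 'a) = - 1"
  hence "of_nat 2 = (0 :: 'a)"
    by (metis add.right_inverse of_nat_numeral one_add_one)
  hence "CHAR('a) dvd 2"
    by (rule of_nat_eq_0_iff_char_dvd[THEN iffD1])
  hence "CHAR('a) \<noteq> 0" "CHAR('a) \<le> 2"
    by (auto intro: dvd_imp_le intro!: notI)
  hence "CHAR('a) = 2"
    using CHAR_not_1'[where ?'a = 'a] by linarith
  hence "even CARD('a)"
    using CHAR_dvd_CARD[where ?'a = 'a] by metis
  thus False
    using odd_card_paley_field[where ?'a = 'a] by contradiction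
qed

lemma power_half_card_cases:
  assumes "x \<noteq> (0 :: 'a :: paley_field)"
  shows "x ^ ((CARD('a) - 1) div 2) = 1 \<or> x ^ ((CARD('a) - 1) div 2) = - 1"
proof -
  obtain n where "CARD('a) = Suc n"
    using card_paley_field_gt_1[where ?'a = 'a] by (cases "CARD('a)") auto
  hence "x * x ^ (CARD('a) - 1) = x"
    using finite_field_power_card_eq_same[of x] by simp
  hence "x ^ (CARD('a) - 1) = 1"
    using assms by simp
  moreover have "(CARD('a) - 1) div 2 * 2 = CARD('a) - 1"
    using odd_card_paley_field[where ?'a = 'a] by simp
  ultimately have "(x ^ ((CARD('a) - 1) div 2)) ^ 2 = 1"
    by (metis power_mult)
  thus ?thesis
    by (simp add: power2_eq_1_iff)
qed

text \<open>Raising x^2 = -1 to the odd power (q-1)/2 would give 1 on the left and -1 on the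
  right.\<close>

lemma square_neq_minus_one: "x * x \<noteq> (- 1 :: 'a :: paley_field)"
proof
  assume x: "x * x = - 1"
  hence "x \<noteq> 0"
    by auto
  hence "(x ^ ((CARD('a) - 1) div 2)) ^ 2 = 1"
    using power_half_card_cases[of x] by auto
  hence "(x * x) ^ ((CARD('a) - 1) div 2) = 1"
    by (simp add: power_mult_distrib power2_eq_square)
  thus False
    using x odd_half_card_paley_field[where ?'a = 'a] one_neq_minus_one_paley_field[where ?'a = 'a]
    by simp
qed

text \<open>Otherwise y / x would be a square root of -1. So the norm of the quadratic extension
  vanishes only at 0, which its inverse relies on.\<close>

lemma sum_squares_eq_0_iff_paley:
  "x * x + y * y = 0 \<longleftrightarrow> x = 0 \<and> y = (0 :: 'a :: paley_field)"
proof -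
  have "(y / x) * (y / x) = - 1" if "x * x + y * y = 0" "x \<noteq> 0"
  proof -
    have "y * y = - (x * x)"
      using that(1) by (simp add: eq_neg_iff_add_eq_0 add.commute)
    thus ?thesis
      using that(2) by simp
  qed
  thus ?thesis
    using square_neq_minus_one[of "y / x"] by (cases "x = 0") auto
qed

text \<open>The quadratic character, defined through Euler's criterion, which makes it multiplicative
  without counting squares.\<close>

definition eta :: "'a :: paley_field \<Rightarrow> int" where
  "eta x = (if x = 0 then 0 else if x ^ ((CARD('a) - 1) div 2) = 1 then 1 else - 1)"

lemma eta_0 [simp]: "eta 0 = 0"
  by (simp add: eta_def)

lemma eta_cases:
  assumes "x \<noteq> (0 :: 'a :: paley_field)"
  shows "x ^ ((CARD('a) - 1) div 2) = 1 \<and> eta x = 1 \<or>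
    x ^ ((CARD('a) - 1) div 2) = - 1 \<and> eta x = - 1"
  using power_half_card_cases[OF assms] assms one_neq_minus_one_paley_field[where ?'a = 'a]
  by (metis eta_def)

lemma eta_mult: "eta (x * y) = eta x * eta y"
proof (cases "x = 0 \<or> y = 0")
  case False
  hence "x \<noteq> 0" "y \<noteq> 0" "x * y \<noteq> 0"
    by auto
  from this[THEN eta_cases] show ?thesis
    using one_neq_minus_one_paley_field[where ?'a = 'a]
    unfolding power_mult_distrib by (metis mult_1 mult_1_right mult_minus1 minus_minus)
qed auto

text \<open>Here q = 3 mod 4 enters: the exponent (q-1)/2 is odd, so Euler's criterion gives -1 at
  -1.\<close>

lemma eta_minus [simp]: "eta (- x) = - eta x"
proof -
  have "eta (- 1 :: 'a) = - 1"
    using odd_half_card_paley_field[where ?'a = 'a] one_neq_minus_one_paley_field[where ?'a = 'a]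
    by (simp add: eta_def)
  thus ?thesis
    using eta_mult[of "- 1" x] by simp
qed

lemma abs_eta: "\<bar>eta x\<bar> = of_bool (x \<noteq> 0)"
  by (simp add: eta_def)

lemma eta_square: "x \<noteq> 0 \<Longrightarrow> eta x * eta x = 1"
  by (simp add: eta_def)

section \<open>Vanishing sums of odd functions\<close>

lemma sum_odd_eq_0:
  fixes f :: "'a :: {ab_group_add, finite} \<Rightarrow> int"
  assumes "\<And>x. f (- x) = - f x"
  shows "sum f UNIV = 0"
proof -
  have "sum f UNIV = (\<Sum>x\<in>UNIV. f (- x))"
    by (rule sum.reindex_bij_witness[of _ uminus uminus]) auto
  also have "\<dots> = - sum f UNIV"
    by (simp add: assms sum_negf)
  finally show ?thesis
    by simp
qed

lemma sum_eta_affine: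
  fixes a b :: "'a :: paley_field"
  assumes "a \<noteq> 0"
  shows "(\<Sum>x\<in>UNIV. eta (x * a + b)) = 0"
proof -
  have "bij (\<lambda>x. x * a + b)"
    by (rule bij_betw_byWitness[where f' = "\<lambda>y. (y - b) / a"]) (use assms in auto)
  from sum.reindex_bij_betw[OF this, of eta] show ?thesis
    by (simp add: sum_odd_eq_0)
qed

section \<open>The quadratic extension\<close>

text \<open>\<open>Quad x y\<close> stands for x + y i with i^2 = -1; the base field is embedded as
  \<open>Quad a 0\<close>.\<close>

datatype 'a quad_ext = Quad (re: 'a) (im: 'a)

instantiation quad_ext :: (paley_field) Fields.field
begin

definition "0 = Quad 0 0"
definition "1 = Quad 1 0"
definition "- x = Quad (- re x) (- im x)"
definition "x + y = Quad (re x + re y) (im x + im y)"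
definition "x - y = Quad (re x - re y) (im x - im y)"
definition "x * y = Quad (re x * re y - im x * im y) (re x * im y + im x * re y)"
text \<open>The conjugate over the norm. At 0 both quotients are 0 / 0 = 0, as the field class
  requires.\<close>

definition "inverse x = Quad (re x / (re x * re x + im x * im x)) (- im x / (re x * re x + im x * im x))"
definition "x div y = x * inverse (y :: 'a quad_ext)"

instance
proof
  fix x y z :: "'a quad_ext"
  show "inverse x * x = 1" if "x \<noteq> 0"
  proof -
    have "re x * re x + im x * im x \<noteq> 0"
      using that by (cases x) (simp add: sum_squares_eq_0_iff_paley zero_quad_ext_def)
    thus ?thesis
      by (simp add: times_quad_ext_def one_quad_ext_def inverse_quad_ext_def flip: add_divide_distrib)
  qed
qed (auto simp: zero_quad_ext_def one_quad_ext_def uminus_quad_ext_def plus_quad_ext_def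
      minus_quad_ext_def times_quad_ext_def inverse_quad_ext_def divide_quad_ext_def algebra_simps)

end

lemma quad_ext_sel [simp]:
  "re 0 = 0" "im 0 = 0" "re 1 = 1" "im 1 = 0"
  "re (- x) = - re x" "im (- x) = - im x"
  "re (x + y) = re x + re y" "im (x + y) = im x + im y"
  "re (x - y) = re x - re y" "im (x - y) = im x - im y"
  "re (x * y) = re x * re y - im x * im y" "im (x * y) = re x * im y + im x * re y"
  by (simp_all add: zero_quad_ext_def one_quad_ext_def uminus_quad_ext_def plus_quad_ext_def
      minus_quad_ext_def times_quad_ext_def)

lemma quad_ext_eq_iff: "x = y \<longleftrightarrow> re x = re y \<and> im x = im y"
  by (cases x; cases y) simp

lemma im_inverse_eq_0_iff [simp]: "im (inverse x) = 0 \<longleftrightarrow> im x = 0"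
  for x :: "'a :: paley_field quad_ext"
  by (auto simp: inverse_quad_ext_def sum_squares_eq_0_iff_paley)

lemma UNIV_quad_ext: "UNIV = (\<lambda>(x, y). Quad x y) ` (UNIV \<times> UNIV)"
  by (auto simp: image_iff) (metis quad_ext.exhaust)

lemma inj_on_Quad: "inj_on (\<lambda>(x, y). Quad x y) A"
  by (auto simp: inj_on_def)

instance quad_ext :: (finite) finite
  by standard (simp add: UNIV_quad_ext)

lemma card_quad_ext: "CARD('a :: finite quad_ext) = CARD('a) ^ 2"
  unfolding UNIV_quad_ext by (subst card_image[OF inj_on_Quad])
    (simp add: card_cartesian_product power2_eq_square)

text \<open>The imaginary part is summed outside, so that the inner sum runs over the real part
  alone, where \<open>sum_eta_affine\<close> applies.\<close>

lemma sum_quad_ext: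
  "(\<Sum>z\<in>UNIV. f z) = (\<Sum>y\<in>UNIV. \<Sum>x\<in>UNIV. f (Quad x y))" for f :: "'a :: finite quad_ext \<Rightarrow> int"
proof -
  have "bij (\<lambda>(y, x). Quad x y :: 'a quad_ext)"
    by (rule bij_betw_byWitness[where f' = "\<lambda>z. (im z, re z)"]) auto
  from sum.reindex_bij_betw[OF this, of f]
  have "(\<Sum>z\<in>UNIV. f z) = (\<Sum>(y, x)\<in>UNIV \<times> UNIV. f (Quad x y))"
    by (simp add: case_prod_unfold)
  thus ?thesis
    by (simp only: sum.cartesian_product)
qed

text \<open>The extension of \<open>eta\<close> by zero from the base field. It stays odd, but is
  multiplicative only for factors from the base field.\<close>

definition chi :: "'a :: paley_field quad_ext \<Rightarrow> int" where
  "chi z = (if im z = 0 then eta (re z) else 0)"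

lemma chi_0 [simp]: "chi 0 = 0"
  by (simp add: chi_def)

lemma chi_minus [simp]: "chi (- z) = - chi z"
  by (simp add: chi_def)

lemma chi_Quad_mult: "a \<noteq> 0 \<Longrightarrow> chi (Quad a 0 * z) = eta a * chi z"
  by (auto simp: chi_def eta_mult)

lemma sum_chi_mult: "(\<Sum>z\<in>UNIV. chi (z * u)) = 0"
  by (rule sum_odd_eq_0) simp

section \<open>Points of the projective space and the regular spread\<close>

type_synonym 'a vec4 = "'a quad_ext \<times> 'a quad_ext"

definition scale :: "'a :: paley_field quad_ext \<Rightarrow> 'a vec4 \<Rightarrow> 'a vec4" where
  "scale c x = (c * fst x, c * snd x)"

definition omega :: "'a :: paley_field vec4 \<Rightarrow> 'a vec4 \<Rightarrow> 'a quad_ext" where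
  "omega x y = fst x * snd y - snd x * fst y"

text \<open>For nonzero x and y on its K-line, this is the scalar that carries x to y. Off that line
  the value has no meaning and \<open>weight\<close> ignores it.\<close>

definition ratio :: "'a :: paley_field vec4 \<Rightarrow> 'a vec4 \<Rightarrow> 'a quad_ext" where
  "ratio x y = (if fst x \<noteq> 0 then fst y / fst x else snd y / snd x)"

lemma fst_scale [simp]: "fst (scale c x) = c * fst x"
  and snd_scale [simp]: "snd (scale c x) = c * snd x"
  by (simp_all add: scale_def)

lemma scale_scale: "scale c (scale d x) = scale (c * d) x"
  by (simp add: scale_def mult.assoc)

lemma scale_1 [simp]: "scale 1 x = x"
  by (simp add: scale_def)

lemma scale_0 [simp]: "scale 0 x = 0"
  by (simp add: scale_def zero_prod_def)

lemma scale_eq_0_iff [simp]: "scale c x = 0 \<longleftrightarrow> c = 0 \<or> x = 0"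
  by (auto simp: scale_def zero_prod_def prod_eq_iff)

lemma inj_scale:
  assumes "x \<noteq> 0"
  shows "inj (\<lambda>c. scale c x)"
  using assms by (auto simp: inj_def scale_def zero_prod_def prod_eq_iff)

lemma omega_self [simp]: "omega x x = 0"
  by (simp add: omega_def)

lemma omega_commute: "omega y x = - omega x y"
  by (simp add: omega_def)

lemma omega_add [simp]: "omega x (y + z) = omega x y + omega x z"
  by (simp add: omega_def algebra_simps)

lemma omega_scale [simp]: "omega x (scale c y) = c * omega x y"
  by (simp add: omega_def algebra_simps)

lemma omega_scale_left [simp]: "omega (scale c x) y = c * omega x y"
  by (simp add: omega_def algebra_simps)

lemma omega_0 [simp]: "omega x 0 = 0"
  by (simp add: omega_def)

lemma ratio_scale: "x \<noteq> 0 \<Longrightarrow> ratio x (scale c x) = c"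
  by (auto simp: ratio_def zero_prod_def prod_eq_iff)

lemma scale_ratio: "x \<noteq> 0 \<Longrightarrow> omega x y = 0 \<Longrightarrow> scale (ratio x y) x = y"
  by (auto simp: ratio_def omega_def zero_prod_def prod_eq_iff nonzero_divide_eq_eq mult.commute)

lemma omega_eq_0_iff: "x \<noteq> 0 \<Longrightarrow> omega x y = 0 \<longleftrightarrow> y \<in> range (\<lambda>c. scale c x)"
  by (metis (no_types, lifting) omega_scale omega_self mult_zero_right rangeE rangeI scale_ratio)

lemma omega_surj:
  assumes "x \<noteq> 0"
  shows "\<exists>z. omega x z = t"
proof (cases "fst x = 0")
  case True
  hence "omega x (- t / snd x, 0) = t"
    using assms by (auto simp: omega_def zero_prod_def prod_eq_iff)
  thus ?thesis ..
next
  case False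
  hence "omega x (0, t / fst x) = t"
    by (simp add: omega_def)
  thus ?thesis ..
qed

section \<open>Normalised vectors and sums over points\<close>

text \<open>The last coordinate is returned untested, so the value is 0 exactly for the zero
  vector.\<close>

definition lead :: "'a :: paley_field vec4 \<Rightarrow> 'a" where
  "lead x = (if re (fst x) \<noteq> 0 then re (fst x) else if im (fst x) \<noteq> 0 then im (fst x)
     else if re (snd x) \<noteq> 0 then re (snd x) else im (snd x))"

lemma lead_scale [simp]: "lead (scale (Quad a 0) x) = a * lead x"
  by (simp add: lead_def)

lemma Quad_eq_0_iff [simp]: "Quad a b = 0 \<longleftrightarrow> a = 0 \<and> b = 0"
  by (simp add: zero_quad_ext_def)

lemma lead_eq_0_iff [simp]: "lead x = 0 \<longleftrightarrow> x = 0"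
  by (cases x; cases "fst x"; cases "snd x") (auto simp: lead_def zero_prod_def split: if_splits)

text \<open>A point of \<open>PG(3,q)\<close> is represented by the vector whose first nonzero coordinate
  over the base field is 1.\<close>

definition points :: "'a :: paley_field vec4 set" where
  "points = {x. lead x = 1}"

lemma point_neq_0: "x \<in> points \<Longrightarrow> x \<noteq> 0"
  using lead_eq_0_iff[of x] by (simp add: points_def)

lemma Quad_mult_Quad [simp]: "Quad a 0 * Quad b 0 = Quad (a * b) (0 :: 'a :: paley_field)"
  by (simp add: quad_ext_eq_iff)

lemma Quad_1_0 [simp]: "Quad 1 0 = 1"
  by (simp add: one_quad_ext_def)

text \<open>A nonzero vector is its leading coordinate times its normalised multiple.\<close>

lemma bij_betw_scale_points:
  "bij_betw (\<lambda>(a, x). scale (Quad a 0) x) ((UNIV - {0}) \<times> points) (UNIV - {0})"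
proof (rule bij_betw_byWitness[where f' = "\<lambda>x. (lead x, scale (Quad (1 / lead x) 0) x)"])
  show "(\<lambda>(a, x). scale (Quad a 0) x) ` ((UNIV - {0}) \<times> points) \<subseteq> UNIV - {0}"
    by (auto simp: point_neq_0)
  show "(\<lambda>x. (lead x, scale (Quad (1 / lead x) 0) x)) ` (UNIV - {0}) \<subseteq> (UNIV - {0}) \<times> points"
    by (auto simp: points_def)
qed (auto simp: points_def scale_scale)

text \<open>An orbit of the nonzero base-field scalars has q - 1 vectors and contains one point.
  Sums over points are evaluated over all vectors because linear substitutions do not preserve the
  normalisation.\<close>

lemma sum_points:
  fixes g :: "'a :: paley_field vec4 \<Rightarrow> int"
  assumes "g 0 = 0" and g: "\<And>a x. a \<noteq> 0 \<Longrightarrow> g (scale (Quad a 0) x) = g x"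
  shows "(\<Sum>x\<in>UNIV. g x) = (int CARD('a) - 1) * (\<Sum>x\<in>points. g x)"
proof -
  have "(\<Sum>x\<in>UNIV. g x) = (\<Sum>x\<in>UNIV - {0}. g x)"
    using \<open>g 0 = 0\<close> by (subst sum.remove[of UNIV 0]) auto
  also have "\<dots> = (\<Sum>(a, x)\<in>(UNIV - {0 :: 'a}) \<times> points. g (scale (Quad a 0) x))"
    by (subst sum.reindex_bij_betw[OF bij_betw_scale_points, symmetric]) (simp add: case_prod_unfold)
  also have "\<dots> = (\<Sum>a\<in>UNIV - {0 :: 'a}. \<Sum>x\<in>points. g x)"
    unfolding sum.cartesian_product[symmetric] by (intro sum.cong) (auto simp: g)
  also have "\<dots> = (int CARD('a) - 1) * (\<Sum>x\<in>points. g x)"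
    using card_paley_field_gt_1[where ?'a = 'a] by (simp add: card_Diff_subset of_nat_diff)
  finally show ?thesis .
qed

text \<open>This is \<open>sum_points\<close> for the indicator of Q with the zero vector taken out;
  hence the -1 on the left.\<close>

lemma card_points_Collect:
  fixes Q :: "'a :: paley_field vec4 \<Rightarrow> bool"
  assumes "Q 0" and Q: "\<And>a x. a \<noteq> 0 \<Longrightarrow> Q (scale (Quad a 0) x) \<longleftrightarrow> Q x"
  shows "int (card {x. Q x}) - 1 = (int CARD('a) - 1) * int (card {x\<in>points. Q x})"
proof -
  have "(\<Sum>x\<in>UNIV. of_bool (Q x \<and> x \<noteq> 0)) =
      (int CARD('a) - 1) * (\<Sum>x\<in>points. of_bool (Q x \<and> x \<noteq> 0))"
    by (rule sum_points) (auto simp: Q)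
  also have "(\<Sum>x\<in>points. of_bool (Q x \<and> x \<noteq> 0) :: int) = (\<Sum>x\<in>points. of_bool (Q x))"
    by (intro sum.cong) (auto simp: point_neq_0)
  also have "\<dots> = int (card {x\<in>points. Q x})"
    by (simp add: Int_def)
  also have "(\<Sum>x\<in>UNIV. of_bool (Q x \<and> x \<noteq> 0) :: int) = int (card ({x. Q x} - {0}))"
    by (simp add: Int_def set_diff_eq)
  also have "int (card ({x. Q x} - {0})) = int (card {x. Q x}) - 1"
  proof -
    have "card {x. Q x} > 0"
      using \<open>Q 0\<close> card_0_eq[OF finite, of "{x. Q x}"] by (metis empty_iff gr0I mem_Collect_eq)
    thus ?thesis
      using \<open>Q 0\<close> by (simp add: card_Diff_singleton of_nat_diff)
  qed
  finally show ?thesis .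
qed

lemma card_vec4: "card (UNIV :: 'a :: paley_field vec4 set) = CARD('a) ^ 4"
  by (simp add: card_quad_ext flip: power_add UNIV_Times_UNIV)

lemma card_points: "card (points :: 'a :: paley_field vec4 set) = 1 + CARD('a) + CARD('a)^2 + CARD('a)^3"
proof -
  let ?q = "int CARD('a)"
  have "(?q - 1) * int (card (points :: 'a vec4 set)) = ?q ^ 4 - 1"
    using card_points_Collect[of "\<lambda>_ :: 'a vec4. True"] by (simp add: card_quad_ext flip: power_add)
  also have "\<dots> = (?q - 1) * (1 + ?q + ?q^2 + ?q^3)"
    by (simp add: algebra_simps eval_nat_numeral)
  finally have "int (card (points :: 'a vec4 set)) = 1 + ?q + ?q^2 + ?q^3"
    using card_paley_field_gt_1[where ?'a = 'a] by simp
  hence "int (card (points :: 'a vec4 set)) = int (1 + CARD('a) + CARD('a)^2 + CARD('a)^3)"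
    by simp
  thus ?thesis
    by (simp only: of_nat_eq_iff)
qed

text \<open>Every fibre is a translate of the kernel, and the fibres partition the domain.\<close>

lemma card_kernel:
  fixes f :: "'v :: {ab_group_add, finite} \<Rightarrow> 'w :: {ab_group_add, finite}"
  assumes add: "\<And>x y. f (x + y) = f x + f y" and "surj f"
  shows "card {x. f x = 0} * CARD('w) = CARD('v)"
proof -
  have fiber: "card {x. f x = w} = card {x. f x = 0}" for w
  proof -
    obtain z where z: "f z = w"
      using \<open>surj f\<close> by (metis surjD)
    have diff: "f (x - z) = f x - w" for x
      using add[of "x - z" z] unfolding z diff_add_cancel eq_diff_eq by (rule sym)
    have "bij_betw (\<lambda>x. x - z) {x. f x = w} {x. f x = 0}"
      by (rule bij_betw_byWitness[where f' = "\<lambda>x. x + z"]) (auto simp: diff add z)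
    thus ?thesis
      by (rule bij_betw_same_card)
  qed
  have "CARD('v) = card (\<Union>w\<in>UNIV. {x. f x = w})"
    by (rule arg_cong[of _ _ card]) auto
  also have "\<dots> = (\<Sum>w\<in>(UNIV :: 'w set). card {x. f x = w})"
    by (rule card_UN_disjoint) auto
  also have "\<dots> = (\<Sum>w\<in>(UNIV :: 'w set). card {x. f x = 0})"
    by (intro sum.cong refl fiber)
  finally show ?thesis
    by simp
qed

section \<open>Signed symplectic graphs\<close>

text \<open>The first case includes y = x, where the ratio is 1 and the weight 0 for nonzero x; this
  gives the zero diagonal.\<close>

definition weight :: "'a :: paley_field quad_ext \<Rightarrow> 'a vec4 \<Rightarrow> 'a vec4 \<Rightarrow> int" where
  "weight c x y = (if omega x y = 0 then eta (im (ratio x y)) else chi (c * omega x y))"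

definition adjacent :: "'a :: paley_field quad_ext \<Rightarrow> 'a vec4 \<Rightarrow> 'a vec4 \<Rightarrow> bool" where
  "adjacent c x y \<longleftrightarrow> x \<noteq> y \<and> im (c * omega x y) = 0"

lemma adjacent_commute: "adjacent c x y \<longleftrightarrow> adjacent c y x"
proof -
  have "im (c * omega y x) = - im (c * omega x y)"
    by (simp only: omega_commute[of y x] mult_minus_right quad_ext_sel)
  thus ?thesis
    by (auto simp only: adjacent_def neg_equal_0_iff_equal)
qed

lemma ratio_scale_right: "ratio x (scale c y) = c * ratio x y"
  by (simp add: ratio_def)

text \<open>Another vector for the same point changes the sign only by \<open>eta a\<close>. This
  factor cancels in a product of two weights, so \<open>sum_points\<close> applies to inner products
  of rows.\<close>

lemma weight_scale_right:
  assumes "a \<noteq> 0"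
  shows "weight c x (scale (Quad a 0) y) = eta a * weight c x y"
proof -
  have "chi (c * (Quad a 0 * omega x y)) = eta a * chi (c * omega x y)"
    using chi_Quad_mult[OF assms, of "c * omega x y"] by (simp only: mult.left_commute)
  thus ?thesis
    using assms by (simp add: weight_def ratio_scale_right eta_mult)
qed

lemma weight_0_right [simp]: "weight c x 0 = 0"
  by (simp add: weight_def ratio_def)

lemma scale_point_real:
  assumes "x \<in> points" "scale (Quad a 0) x \<in> points"
  shows "scale (Quad a 0) x = x"
  using assms by (auto simp: points_def)

text \<open>If the ratio lay in the base field, the two normalised vectors would be proportional
  over it and hence equal.\<close>

lemma line_through_points:
  assumes "x \<in> points" "y \<in> points" "x \<noteq> y" "omega x y = 0"
  shows "y = scale (ratio x y) x \<and> im (ratio x y) \<noteq> 0"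
proof
  show y: "y = scale (ratio x y) x"
    using assms by (simp add: scale_ratio point_neq_0)
  show "im (ratio x y) \<noteq> 0"
  proof
    assume "im (ratio x y) = 0"
    hence "ratio x y = Quad (re (ratio x y)) 0"
      by (simp add: quad_ext_eq_iff)
    thus False
      using scale_point_real[of x "re (ratio x y)"] assms(1-3) y by metis
  qed
qed

text \<open>On a spread line the weight vanishes only for x = y. Off it,
  \<open>c * omega x y\<close> is nonzero, so its \<open>chi\<close> is 0 exactly when it lies
  outside the base field.\<close>

lemma abs_weight:
  assumes "x \<in> points" "y \<in> points" "c \<noteq> 0"
  shows "\<bar>weight c x y\<bar> = of_bool (adjacent c x y)"
proof (cases "omega x y = 0")
  case True
  have "ratio x x = 1"
    using ratio_scale[of x 1] assms(1) by (simp add: point_neq_0)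
  hence "im (ratio x y) = 0 \<longleftrightarrow> x = y"
    using line_through_points[OF assms(1,2) _ True] by auto
  thus ?thesis
    using True by (simp add: weight_def adjacent_def abs_eta)
next
  case False
  have "c * omega x y \<noteq> 0"
    using False assms(3) by simp
  moreover have "x \<noteq> y"
    using False by auto
  ultimately show ?thesis
    using False unfolding weight_def adjacent_def chi_def
    by (auto simp: abs_eta quad_ext_eq_iff[of _ 0] simp del: quad_ext_sel(11,12) mult_eq_0_iff)
qed

section \<open>Orthogonality of the rows\<close>

lemma sum_weight_mult_points:
  "(\<Sum>z\<in>UNIV. weight c x z * weight c y z) =
    (int CARD('a) - 1) * (\<Sum>z\<in>points. weight c x z * weight c y z)"
  for x y :: "'a :: paley_field vec4"
proof (rule sum_points)
  fix a :: 'a and z :: "'a vec4"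
  assume "a \<noteq> 0"
  thus "weight c x (scale (Quad a 0) z) * weight c y (scale (Quad a 0) z) = weight c x z * weight c y z"
    using eta_square[of a] by (simp add: weight_scale_right algebra_simps)
qed simp

text \<open>Only z on the common K-line contribute. For these, z = \<delta> x, and fixing the
  imaginary part of \<delta> leaves a sum of \<open>eta\<close> along an affine line.\<close>

lemma sum_weight_mult_same_line:
  assumes "x \<noteq> 0" "im \<beta> \<noteq> 0"
  shows "(\<Sum>z\<in>UNIV. weight c x z * weight c (scale \<beta> x) z) = 0"
proof -
  define \<gamma> where "\<gamma> = inverse \<beta>"
  have \<beta>: "\<beta> \<noteq> 0"
    using assms(2) by auto
  \<comment> \<open>As \<beta> is outside the base field, u and \<beta> * u are never both nonzero
    elements of it.\<close>
  have off_line: "chi u * chi (\<beta> * u) = 0" for u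
  proof (cases "im u = 0 \<and> re u \<noteq> 0")
    case True
    thus ?thesis
      using assms(2) by (simp add: chi_def)
  next
    case False
    thus ?thesis
      by (auto simp: chi_def)
  qed
  have "(\<Sum>z\<in>UNIV. weight c x z * weight c (scale \<beta> x) z) =
      (\<Sum>z\<in>range (\<lambda>\<delta>. scale \<delta> x). weight c x z * weight c (scale \<beta> x) z)"
  proof (rule sum.mono_neutral_right)
    show "\<forall>z\<in>UNIV - range (\<lambda>\<delta>. scale \<delta> x). weight c x z * weight c (scale \<beta> x) z = 0"
    proof
      fix z assume "z \<in> UNIV - range (\<lambda>\<delta>. scale \<delta> x)"
      hence "omega x z \<noteq> 0"
        using omega_eq_0_iff[OF assms(1)] by auto
      thus "weight c x z * weight c (scale \<beta> x) z = 0"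
        using \<beta> off_line[of "c * omega x z"] by (simp only: weight_def omega_scale_left
            mult_eq_0_iff[of \<beta>] if_False mult.left_commute[of c \<beta>] simp_thms)
    qed
  qed auto
  also have "\<dots> = (\<Sum>\<delta>\<in>UNIV. weight c x (scale \<delta> x) * weight c (scale \<beta> x) (scale \<delta> x))"
    by (simp add: sum.reindex inj_scale assms(1))
  also have "\<dots> = (\<Sum>\<delta>\<in>UNIV. eta (im \<delta>) * eta (im (\<delta> * \<gamma>)))"
  proof (rule sum.cong)
    fix \<delta>
    have "scale \<delta> x = scale (\<delta> * \<gamma>) (scale \<beta> x)"
      using \<beta> by (simp add: scale_scale \<gamma>_def mult.assoc)
    hence "ratio (scale \<beta> x) (scale \<delta> x) = \<delta> * \<gamma>"
      using ratio_scale[of "scale \<beta> x" "\<delta> * \<gamma>"] \<beta> assms(1) by simp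
    thus "weight c x (scale \<delta> x) * weight c (scale \<beta> x) (scale \<delta> x) = eta (im \<delta>) * eta (im (\<delta> * \<gamma>))"
      using ratio_scale[OF assms(1), of \<delta>] by (simp add: weight_def)
  qed simp
  \<comment> \<open>With \<delta> = \<open>Quad r t\<close>, the first factor depends on t alone and
    the second is affine in r with slope im \<gamma>.\<close>
  also have "\<dots> = (\<Sum>t\<in>UNIV. eta t * (\<Sum>r\<in>UNIV. eta (r * im \<gamma> + t * re \<gamma>)))"
    by (simp add: sum_quad_ext sum_distrib_left)
  also have "\<dots> = 0"
    using assms(2) by (simp add: sum_eta_affine \<gamma>_def)
  finally show ?thesis .
qed

text \<open>Pairing with x recovers b and pairing with y recovers a; injectivity suffices by
  finiteness.\<close>

lemma bij_scale_add:
  assumes w: "omega x y \<noteq> 0"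
  shows "bij (\<lambda>(a, b). scale a x + scale b y)"
proof -
  have "inj (\<lambda>(a, b). scale a x + scale b y)"
  proof (rule injI, clarify)
    fix a b a' b' assume eq: "scale a x + scale b y = scale a' x + scale b' y"
    have "b * omega x y = b' * omega x y" "a * omega y x = a' * omega y x"
      using arg_cong[OF eq, of "omega x"] arg_cong[OF eq, of "omega y"] by simp_all
    thus "a = a' \<and> b = b'"
      using w by (simp add: omega_commute[of x y])
  qed
  thus ?thesis
    by (simp add: bij_def finite_UNIV_inj_surj)
qed

text \<open>With \<open>z = a x + b y\<close>, the terms in which \<open>z\<close> lies on one of the two spread lines
  cancel against each other; this is where \<open>-1\<close> has to be a non-square.\<close>

lemma sum_weight_mult_different_lines:
  fixes x y :: "'a :: paley_field vec4"
  assumes w: "omega x y \<noteq> 0" and c: "c \<noteq> 0"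
  shows "(\<Sum>z\<in>UNIV. weight c x z * weight c y z) = 0"
proof -
  define u where "u = c * omega x y"
  have x: "x \<noteq> 0" and y: "y \<noteq> 0"
    using w by (auto simp: omega_def)
  \<comment> \<open>At b = 0 the \<open>chi\<close> term is 0, elsewhere the indicator is, so the
    sum merges both cases of \<open>weight\<close>.\<close>
  have wx: "weight c x (scale a x + scale b y) = of_bool (b = 0) * eta (im a) + chi (b * u)" for a b
  proof (cases "b = 0")
    case True
    thus ?thesis
      using ratio_scale[OF x] by (simp add: weight_def)
  next
    case False
    thus ?thesis
      using w by (simp add: weight_def u_def mult.left_commute)
  qed
  have wy: "weight c y (scale a x + scale b y) = of_bool (a = 0) * eta (im b) - chi (a * u)" for a b
  proof (cases "a = 0")
    case True
    thus ?thesis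
      using ratio_scale[OF y] by (simp add: weight_def)
  next
    case False
    thus ?thesis
      using w by (simp add: weight_def u_def omega_commute[of x y] mult.left_commute)
  qed
  define f where "f a b = weight c x (scale a x + scale b y) * weight c y (scale a x + scale b y)" for a b
  \<comment> \<open>The product of the two indicator terms is missing because it lives at a = b = 0,
    where \<open>eta\<close> is 0.\<close>
  have f: "f a b = of_bool (a = 0) * (eta (im b) * chi (b * u)) - of_bool (b = 0) * (eta (im a) * chi (a * u))
      - chi (b * u) * chi (a * u)" for a b
    unfolding f_def wx wy by (simp add: algebra_simps)
  have "(\<Sum>z\<in>UNIV. weight c x z * weight c y z) = (\<Sum>(a, b)\<in>UNIV \<times> UNIV. f a b)"
    using sum.reindex_bij_betw[OF bij_scale_add[OF w], of "\<lambda>z. weight c x z * weight c y z"]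
    by (simp add: f_def case_prod_unfold)
  also have "\<dots> = (\<Sum>a\<in>UNIV. \<Sum>b\<in>UNIV. f a b)"
    by (simp only: sum.cartesian_product)
  \<comment> \<open>The first two sums differ only in the name of the variable; the third contains
    the vanishing sum of \<open>chi\<close>.\<close>
  also have "\<dots> = (\<Sum>b\<in>UNIV. eta (im b) * chi (b * u)) - (\<Sum>a\<in>UNIV. eta (im a) * chi (a * u))
      - (\<Sum>a\<in>UNIV. (\<Sum>b\<in>UNIV. chi (b * u)) * chi (a * u))"
    unfolding f sum_subtractf sum_distrib_right[symmetric] sum_distrib_left[symmetric] by (simp add: of_bool_def if_distrib cong: if_cong)
  also have "\<dots> = 0"
    by (simp add: sum_chi_mult)
  finally show ?thesis .
qed

lemma sum_points_weight_mult:
  assumes "x \<in> points" "y \<in> points" "x \<noteq> y" "c \<noteq> 0"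
  shows "(\<Sum>z\<in>points. weight c x z * weight c y z) = 0"
proof -
  have "(\<Sum>z\<in>UNIV. weight c x z * weight c y z) = 0"
  proof (cases "omega x y = 0")
    case True
    from line_through_points[OF assms(1-3) True] obtain \<beta> where "y = scale \<beta> x" "im \<beta> \<noteq> 0"
      by blast
    thus ?thesis
      using sum_weight_mult_same_line[OF point_neq_0[OF assms(1)]] by simp
  next
    case False
    thus ?thesis
      using assms(4) by (rule sum_weight_mult_different_lines)
  qed
  thus ?thesis
    using sum_weight_mult_points[of c x y] card_paley_field_gt_1[where ?'a = 'a] by simp
qed

section \<open>Counting points orthogonal to given points\<close>

lemma im_mult_surj:
  assumes "im \<beta> \<noteq> 0"
  shows "\<exists>t. im t = a \<and> im (\<beta> * t) = (b :: 'a :: paley_field)"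
  using assms by (intro exI[of _ "Quad ((b - re \<beta> * a) / im \<beta>) a"]) simp

lemma surj_im_omega:
  assumes "x \<noteq> 0" "c \<noteq> 0"
  shows "surj (\<lambda>z. im (c * omega x z))"
proof (unfold surj_def, rule allI)
  fix a
  obtain z where "omega x z = Quad 0 a / c"
    using omega_surj[OF assms(1)] by blast
  hence "c * omega x z = Quad 0 a"
    using assms(2) by simp
  hence "im (c * omega x z) = a"
    by (simp only: quad_ext.sel)
  thus "\<exists>z. a = im (c * omega x z)"
    by blast
qed

text \<open>Distinct points give independent functionals over the base field. On one spread line
  both values come from a single t and its multiple by \<beta>; on different lines they are
  prescribed separately.\<close>

lemma surj_im_omega_pair:
  fixes x y :: "'a :: paley_field vec4"
  assumes x: "x \<in> points" and y: "y \<in> points" and "x \<noteq> y" and c: "c \<noteq> 0"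
  shows "surj (\<lambda>z. (im (c * omega x z), im (c * omega y z)))"
proof -
  have "\<exists>z. im (c * omega x z) = a \<and> im (c * omega y z) = b" for a b
  proof (cases "omega x y = 0")
    case True
    obtain \<beta> where \<beta>: "y = scale \<beta> x" "im \<beta> \<noteq> 0"
      using line_through_points[OF x y \<open>x \<noteq> y\<close> True] by blast
    obtain t where t: "im t = a" "im (\<beta> * t) = b"
      using im_mult_surj[OF \<beta>(2)] by blast
    obtain z where "omega x z = t / c"
      using omega_surj[OF point_neq_0[OF x]] by blast
    hence "c * omega x z = t"
      using c by simp
    moreover from this have "c * omega y z = \<beta> * t"
      unfolding \<beta>(1) omega_scale_left by (simp only: mult.left_commute[of c \<beta>])
    ultimately show ?thesis
      using t by metis
  next
    case False
    define w where "w = c * omega x y"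
    have w: "w \<noteq> 0"
      using c False by (simp add: w_def)
    \<comment> \<open>The x-component determines only \<open>omega y z\<close> and the y-component
      only \<open>omega x z\<close>; the minus sign makes up for
      \<open>omega y x = - omega x y\<close>.\<close>
    define z where "z = scale (- Quad 0 b / w) x + scale (Quad 0 a / w) y"
    have "c * omega x z = Quad 0 a / w * w" "c * omega y z = Quad 0 b / w * w"
      unfolding z_def omega_add omega_scale omega_self omega_commute[of x y] w_def
      by (simp_all only: mult_zero_right add_0_left add_0_right mult_minus_left mult_minus_right minus_minus
          minus_divide_left[symmetric] mult.left_commute[of c])
    hence "im (c * omega x z) = a" "im (c * omega y z) = b"
      using w by simp_all
    thus ?thesis
      by blast
  qed
  thus ?thesis
    by (auto simp: surj_def) metis
qed

lemma im_omega_add: "im (c * omega x (y + z)) = im (c * omega x y) + im (c * omega x z)"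
  by (simp only: omega_add distrib_left quad_ext_sel)

lemma im_omega_scale_real: "im (c * omega x (scale (Quad a 0) y)) = a * im (c * omega x y)"
  unfolding omega_scale mult.left_commute[of c "Quad a 0"] by simp

text \<open>The kernel of the functional has q^3 vectors. A point x is itself counted here, so its
  degree will be q + q^2.\<close>

lemma card_points_perp:
  fixes x :: "'a :: paley_field vec4"
  assumes "x \<noteq> 0" "c \<noteq> 0"
  shows "card {z\<in>points. im (c * omega x z) = 0} = 1 + CARD('a) + CARD('a)^2"
proof -
  let ?q = "int CARD('a)"
  let ?H = "{z. im (c * omega x z) = 0}"
  have "card ?H * CARD('a) = CARD('a vec4)"
    by (rule card_kernel) (simp_all only: im_omega_add surj_im_omega assms not_False_eq_True)
  hence "card ?H = CARD('a) ^ 3"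
    using card_paley_field_gt_1[where ?'a = 'a] unfolding card_vec4 by (simp add: eval_nat_numeral)
  moreover have "int (card ?H) - 1 = (?q - 1) * int (card {z\<in>points. im (c * omega x z) = 0})"
    by (rule card_points_Collect) (simp_all only: im_omega_scale_real omega_0 mult_zero_right quad_ext_sel(1,2) mult_eq_0_iff simp_thms)
  ultimately have "(?q - 1) * int (card {z\<in>points. im (c * omega x z) = 0}) = ?q ^ 3 - 1"
    by simp
  also have "\<dots> = (?q - 1) * (1 + ?q + ?q^2)"
    by (simp add: algebra_simps eval_nat_numeral)
  finally have "int (card {z\<in>points. im (c * omega x z) = 0}) = int (1 + CARD('a) + CARD('a)^2)"
    using card_paley_field_gt_1[where ?'a = 'a] by simp
  thus ?thesis
    by (simp only: of_nat_eq_iff)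
qed

text \<open>The count does not depend on whether x and y are orthogonal. If they are, both are among
  the q + 1 points, which leaves q - 1 common neighbours.\<close>

lemma card_points_perp2:
  fixes x y :: "'a :: paley_field vec4"
  assumes "x \<in> points" "y \<in> points" "x \<noteq> y" "c \<noteq> 0"
  shows "card {z\<in>points. im (c * omega x z) = 0 \<and> im (c * omega y z) = 0} = 1 + CARD('a)"
proof -
  let ?q = "int CARD('a)"
  let ?Q = "\<lambda>z. im (c * omega x z) = 0 \<and> im (c * omega y z) = 0"
  have "card {z. (im (c * omega x z), im (c * omega y z)) = 0} * CARD('a \<times> 'a) = CARD('a vec4)"
    by (rule card_kernel) (simp_all only: im_omega_add surj_im_omega_pair assms not_False_eq_True
        add_Pair)
  hence "card {z. ?Q z} * CARD('a) ^ 2 = CARD('a) ^ 4"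
    unfolding card_vec4 by (simp only: zero_prod_def prod.inject card_prod power2_eq_square)
  hence "card {z. ?Q z} = CARD('a) ^ 2"
    using card_paley_field_gt_1[where ?'a = 'a] by (simp add: eval_nat_numeral)
  moreover have "int (card {z. ?Q z}) - 1 = (?q - 1) * int (card {z\<in>points. ?Q z})"
    by (rule card_points_Collect) (simp_all only: im_omega_scale_real omega_0 mult_zero_right quad_ext_sel(1,2) mult_eq_0_iff simp_thms)
  ultimately have "(?q - 1) * int (card {z\<in>points. ?Q z}) = ?q ^ 2 - 1"
    by simp
  also have "\<dots> = (?q - 1) * (1 + ?q)"
    by (simp add: algebra_simps power2_eq_square)
  finally have "int (card {z\<in>points. ?Q z}) = int (1 + CARD('a))"
    using card_paley_field_gt_1[where ?'a = 'a] by simp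
  thus ?thesis
    by (simp only: of_nat_eq_iff)
qed

text \<open>A K-line has q^2 vectors; the result is the size of the common cliques.\<close>

lemma card_points_line:
  fixes x :: "'a :: paley_field vec4"
  assumes "x \<noteq> 0"
  shows "card {z\<in>points. omega x z = 0} = 1 + CARD('a)"
proof -
  let ?q = "int CARD('a)"
  have "{z. omega x z = 0} = range (\<lambda>c. scale c x)"
    using omega_eq_0_iff[OF assms] by blast
  hence "card {z. omega x z = 0} = CARD('a) ^ 2"
    using card_image[OF inj_scale[OF assms]] by (simp only: card_quad_ext)
  moreover have "int (card {z. omega x z = 0}) - 1 = (?q - 1) * int (card {z\<in>points. omega x z = 0})"
    by (rule card_points_Collect) simp_all
  ultimately have "(?q - 1) * int (card {z\<in>points. omega x z = 0}) = ?q ^ 2 - 1"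
    by simp
  also have "\<dots> = (?q - 1) * (1 + ?q)"
    by (simp add: algebra_simps power2_eq_square)
  finally have "int (card {z\<in>points. omega x z = 0}) = int (1 + CARD('a))"
    using card_paley_field_gt_1[where ?'a = 'a] by simp
  thus ?thesis
    by (simp only: of_nat_eq_iff)
qed

lemma sum_of_bool_finite: "(\<Sum>x\<in>A. of_bool (P x)) = int (card {x\<in>A. P x})" for A :: "'a :: finite set"
  by (simp add: Int_def)

lemma sum_of_bool_eq_mult:
  fixes f :: "'a :: finite \<Rightarrow> int"
  assumes "a \<in> A"
  shows "(\<Sum>x\<in>A. of_bool (x = a) * f x) = f a"
proof -
  have "A \<inter> {x. x = a} = {a}"
    using assms by auto
  thus ?thesis
    by simp
qed

text \<open>Let N be the matrix of orthogonality, with ones on the diagonal. Then A = N - I and A^2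
  = N^2 - 2 N + I, where N^2 = q^2 I + (q + 1) J by the two counts.\<close>

lemma sum_points_adjacent:
  fixes x y :: "'a :: paley_field vec4"
  assumes x: "x \<in> points" and y: "y \<in> points" and c: "c \<noteq> 0"
  defines "q \<equiv> int CARD('a)"
  shows "(\<Sum>z\<in>points. of_bool (adjacent c x z) * of_bool (adjacent c z y)) =
    (q + q^2) * of_bool (x = y) + (q - 1) * of_bool (adjacent c x y)
      + (q + 1) * (1 - of_bool (x = y) - of_bool (adjacent c x y))"
proof -
  let ?N = "\<lambda>x y. of_bool (im (c * omega x y) = 0) :: int"
  let ?A = "\<lambda>x y. of_bool (adjacent c x y) :: int"
  have N_commute: "?N x y = ?N y x" for x y
    unfolding omega_commute[of x y] by (simp only: mult_minus_right quad_ext_sel neg_equal_0_iff_equal)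
  have A: "?A x y = ?N x y - of_bool (x = y)" for x y
    by (cases "x = y") (simp_all add: adjacent_def)
  have N: "(\<Sum>z\<in>points. ?N x z * ?N y z) = (q + 1) + q^2 * of_bool (x = y)"
  proof (cases "x = y")
    case True
    have "(\<Sum>z\<in>points. ?N x z * ?N y z) = (\<Sum>z\<in>points. ?N x z)"
      using True by (simp only: of_bool_conj[symmetric] simp_thms)
    also have "\<dots> = int (card {z\<in>points. im (c * omega x z) = 0})"
      by (rule sum_of_bool_finite)
    finally show ?thesis
      using True card_points_perp[OF point_neq_0[OF x] c] by (simp add: q_def)
  next
    case False
    have "(\<Sum>z\<in>points. ?N x z * ?N y z) =
        int (card {z\<in>points. im (c * omega x z) = 0 \<and> im (c * omega y z) = 0})"
      by (simp only: of_bool_conj[symmetric] sum_of_bool_finite)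
    thus ?thesis
      using False card_points_perp2[OF x y False c] by (simp add: q_def)
  qed
  have "(\<Sum>z\<in>points. ?A x z * ?A z y) =
      (\<Sum>z\<in>points. ?N x z * ?N y z - of_bool (z = x) * ?N y z - of_bool (z = y) * ?N x z
        + of_bool (z = x) * of_bool (z = y))"
    by (rule sum.cong) (simp_all only: A N_commute[of _ y] eq_commute[of x] algebra_simps)
  also have "\<dots> = (\<Sum>z\<in>points. ?N x z * ?N y z) - ?N y x - ?N x y + of_bool (x = y)"
    unfolding sum.distrib sum_subtractf sum_of_bool_eq_mult[OF x] sum_of_bool_eq_mult[OF y] ..
  also have "\<dots> = q^2 * of_bool (x = y) + (q + 1) - 2 * ?N x y + of_bool (x = y)"
    unfolding N N_commute[of y x] by simp
  also have "?N x y = ?A x y + of_bool (x = y)"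
    by (simp add: A)
  finally show ?thesis
    by (simp add: algebra_simps)
qed

text \<open>Representatives of the nonzero elements of K modulo those of F, that is, of the
  projective line over F with \<open>None\<close> as the point at infinity.\<close>

definition direction :: "'a :: paley_field option \<Rightarrow> 'a quad_ext" where
  "direction d = (case d of None \<Rightarrow> Quad 0 1 | Some s \<Rightarrow> Quad 1 s)"

lemma direction_neq_0: "direction d \<noteq> 0"
  by (simp add: direction_def split: option.split)

text \<open>The condition is a nonzero linear equation over F in the two coordinates of the
  direction, so it has one solution up to scalars.\<close>

lemma ex1_direction:
  assumes "w \<noteq> 0"
  shows "\<exists>!d. im (direction d * w) = 0"
proof (cases "re w = 0")
  case True
  hence "im w \<noteq> 0"
    using assms by (simp add: quad_ext_eq_iff)
  thus ?thesis
    using True by (intro ex1I[of _ None]) (auto simp: direction_def split: option.splits)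
next
  case False
  show ?thesis
  proof (rule ex1I[of _ "Some (- im w / re w)"])
    show "im (direction (Some (- im w / re w)) * w) = 0"
      using False by (simp add: direction_def)
    fix d assume d: "im (direction d * w) = 0"
    show "d = Some (- im w / re w)"
    proof (cases d)
      case None
      thus ?thesis
        using d False by (simp add: direction_def)
    next
      case (Some s)
      hence "s * re w = - im w"
        using d by (simp add: direction_def eq_neg_iff_add_eq_0 add.commute)
      hence "s = - im w / re w"
        using False by (metis nonzero_mult_div_cancel_right)
      thus ?thesis
        using Some by simp
    qed
  qed
qed

section \<open>Matrices and graphs on an initial segment of the naturals\<close>

definition edges :: "nat \<Rightarrow> (nat \<Rightarrow> nat \<Rightarrow> bool) \<Rightarrow> nat set set" where
  "edges v R = {{i, j} | i j. i < v \<and> j < v \<and> R i j}"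

lemma mem_edges_iff:
  assumes "\<And>i j. R i j \<longleftrightarrow> R j i"
  shows "{i, j} \<in> edges v R \<longleftrightarrow> i < v \<and> j < v \<and> R i j"
  using assms by (auto simp: edges_def doubleton_eq_iff)

lemma simple_graph_edges:
  assumes "\<And>i. \<not> R i i"
  shows "simple_graph v (edges v R)"
  using assms by (auto simp: simple_graph_def complete_graph_def edges_def card_2_iff) metis

text \<open>Matrices are indexed by natural numbers, so an arbitrary numbering of the points is
  fixed.\<close>

locale point_enumeration =
  fixes h :: "nat \<Rightarrow> 'a :: paley_field vec4" and q v :: nat
  assumes q_def: "q = CARD('a)" and v_def: "v = 1 + q + q^2 + q^3"
    and bij_h: "bij_betw h {..<v} points"
begin

lemma h_point: "i < v \<Longrightarrow> h i \<in> points"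
  using bij_h by (auto simp: bij_betw_def)

lemma h_eq_iff: "i < v \<Longrightarrow> j < v \<Longrightarrow> h i = h j \<longleftrightarrow> i = j"
  using bij_h by (auto simp: bij_betw_def inj_on_def)

lemma sum_h: "(\<Sum>k<v. f (h k)) = (\<Sum>z\<in>points. f z)"
  by (rule sum.reindex_bij_betw[OF bij_h])

definition signed_matrix :: "'a quad_ext \<Rightarrow> int mat" where
  "signed_matrix c = mat v v (\<lambda>(i, j). weight c (h i) (h j))"

definition symplectic_graph :: "'a quad_ext \<Rightarrow> nat set set" where
  "symplectic_graph c = edges v (\<lambda>i j. adjacent c (h i) (h j))"

definition spread_graph :: "nat set set" where
  "spread_graph = edges v (\<lambda>i j. i \<noteq> j \<and> omega (h i) (h j) = 0)"

lemma mem_symplectic_graph: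
  "{i, j} \<in> symplectic_graph c \<longleftrightarrow> i < v \<and> j < v \<and> adjacent c (h i) (h j)"
  unfolding symplectic_graph_def by (rule mem_edges_iff) (rule adjacent_commute)

lemma mem_spread_graph:
  "{i, j} \<in> spread_graph \<longleftrightarrow> i < v \<and> j < v \<and> i \<noteq> j \<and> omega (h i) (h j) = 0"
  unfolding spread_graph_def
proof (rule mem_edges_iff)
  show "(i \<noteq> j \<and> omega (h i) (h j) = 0) \<longleftrightarrow> (j \<noteq> i \<and> omega (h j) (h i) = 0)" for i j
    using omega_commute[of "h i" "h j"] by auto
qed

lemma adjacency_symplectic_graph:
  "adjacency_matrix v (symplectic_graph c) = mat v v (\<lambda>(i, j). of_bool (adjacent c (h i) (h j)))"
  unfolding adjacency_matrix_def by (rule eq_matI) (auto simp: mem_symplectic_graph)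

lemma abs_signed_matrix:
  assumes "c \<noteq> 0"
  shows "abs_mat (signed_matrix c) = adjacency_matrix v (symplectic_graph c)"
  unfolding adjacency_symplectic_graph abs_mat_def signed_matrix_def
  by (rule eq_matI) (auto simp: abs_weight h_point assms)

lemma adjacency_symplectic_graph_squared:
  assumes c: "c \<noteq> 0"
  defines "A \<equiv> adjacency_matrix v (symplectic_graph c)"
  shows "A * A = int (q + q^2) \<cdot>\<^sub>m 1\<^sub>m v + int (q - 1) \<cdot>\<^sub>m A
    + int (q + 1) \<cdot>\<^sub>m (all_ones_mat v - 1\<^sub>m v - A)"
proof (rule eq_matI)
  note [simp] = A_def adjacency_symplectic_graph all_ones_mat_def
  \<comment> \<open>The parameter q - 1 is a truncated difference of naturals; q > 1 makes it agree
    with the integer one.\<close>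
  have q: "int (q - Suc 0) = int q - 1"
    using card_paley_field_gt_1[where ?'a = 'a] by (simp add: q_def of_nat_diff)
  fix i j assume "i < dim_row (int (q + q^2) \<cdot>\<^sub>m 1\<^sub>m v + int (q - 1) \<cdot>\<^sub>m A
      + int (q + 1) \<cdot>\<^sub>m (all_ones_mat v - 1\<^sub>m v - A))"
    and "j < dim_col (int (q + q^2) \<cdot>\<^sub>m 1\<^sub>m v + int (q - 1) \<cdot>\<^sub>m A
      + int (q + 1) \<cdot>\<^sub>m (all_ones_mat v - 1\<^sub>m v - A))"
  hence ij: "i < v" "j < v"
    by simp_all
  have "(A * A) $$ (i, j) =
      (\<Sum>k<v. of_bool (adjacent c (h i) (h k)) * of_bool (adjacent c (h k) (h j)))"
    using ij by (simp add: scalar_prod_def atLeast0LessThan del: sum_of_bool_mult_eq sum_mult_of_bool_eq)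
  also have "\<dots> = (\<Sum>z\<in>points. of_bool (adjacent c (h i) z) * of_bool (adjacent c z (h j)))"
    by (rule sum_h)
  also note sum_points_adjacent[OF h_point[OF ij(1)] h_point[OF ij(2)] c]
  finally show "(A * A) $$ (i, j) = (int (q + q^2) \<cdot>\<^sub>m 1\<^sub>m v + int (q - 1) \<cdot>\<^sub>m A
      + int (q + 1) \<cdot>\<^sub>m (all_ones_mat v - 1\<^sub>m v - A)) $$ (i, j)"
    using ij by (simp add: h_eq_iff q q_def[symmetric])
qed (simp_all add: A_def adjacency_symplectic_graph all_ones_mat_def)

lemma strongly_regular_symplectic_graph:
  assumes "c \<noteq> 0"
  shows "strongly_regular_graph v (q + q^2) (q - 1) (q + 1) (symplectic_graph c)"
  unfolding strongly_regular_graph_def Let_def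
proof
  show "simple_graph v (symplectic_graph c)"
    unfolding symplectic_graph_def by (rule simple_graph_edges) (simp add: adjacent_def)
qed (rule adjacency_symplectic_graph_squared[OF assms])

lemma weighing_signed_matrix:
  assumes c: "c \<noteq> 0"
  shows "weighing_matrix v (q + q^2) (signed_matrix c)"
  unfolding weighing_matrix_def
proof (intro conjI)
  let ?W = "signed_matrix c"
  show W: "?W \<in> carrier_mat v v"
    by (simp add: signed_matrix_def)
  show "elements_mat ?W \<subseteq> {0, 1, - 1}"
  proof
    fix a assume "a \<in> elements_mat ?W"
    then obtain i j where ij: "i < v" "j < v" "a = ?W $$ (i, j)"
      using elements_matD[of a ?W] carrier_matD[OF W] by metis
    hence "\<bar>a\<bar> = of_bool (adjacent c (h i) (h j))"
      by (simp add: signed_matrix_def abs_weight h_point c)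
    thus "a \<in> {0, 1, - 1}"
      by (auto simp: of_bool_def split: if_splits)
  qed
  show "?W * transpose_mat ?W = int (q + q^2) \<cdot>\<^sub>m 1\<^sub>m v"
  proof (rule eq_matI)
    fix i j assume "i < dim_row (int (q + q^2) \<cdot>\<^sub>m 1\<^sub>m v)" "j < dim_col (int (q + q^2) \<cdot>\<^sub>m 1\<^sub>m v)"
    hence ij: "i < v" "j < v"
      by simp_all
    have "(?W * transpose_mat ?W) $$ (i, j) = (\<Sum>k<v. weight c (h i) (h k) * weight c (h j) (h k))"
      using ij by (simp add: signed_matrix_def scalar_prod_def atLeast0LessThan)
    also have "\<dots> = (\<Sum>z\<in>points. weight c (h i) z * weight c (h j) z)"
      by (rule sum_h)
    also have "\<dots> = int (q + q^2) * of_bool (i = j)"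
    proof (cases "i = j")
      case True
      \<comment> \<open>Squares forget the signs, so the diagonal of W W^T is that of A^2, the
        degree.\<close>
      have "(\<Sum>z\<in>points. weight c (h i) z * weight c (h i) z) =
          (\<Sum>z\<in>points. of_bool (adjacent c (h i) z) * of_bool (adjacent c z (h i)))"
      proof (rule sum.cong)
        fix z :: "'a vec4" assume "z \<in> points"
        thus "weight c (h i) z * weight c (h i) z = of_bool (adjacent c (h i) z) * of_bool (adjacent c z (h i))"
          using abs_weight[OF h_point[OF ij(1)] _ c, of z] adjacent_commute[of c z "h i"]
            abs_mult_self_eq[of "weight c (h i) z"] by simp
      qed simp
      also have "\<dots> = int (q + q^2)"
        using sum_points_adjacent[OF h_point h_point c, of i i] ij(1)
        by (simp only: adjacent_def) (simp add: q_def)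
      finally show ?thesis
        using True by simp
    next
      case False
      thus ?thesis
        using ij sum_points_weight_mult[OF h_point h_point _ c, of i j] by (simp add: h_eq_iff)
    qed
    finally show "(?W * transpose_mat ?W) $$ (i, j) = (int (q + q^2) \<cdot>\<^sub>m 1\<^sub>m v) $$ (i, j)"
      using ij by simp
  qed (simp_all add: signed_matrix_def)
qed

text \<open>The absolute value is the symmetric matrix A, so both products are A^2, whose
  off-diagonal entries are q - 1 or q + 1.\<close>

lemma quasi_balanced_signed_matrix:
  assumes c: "c \<noteq> 0"
  shows "quasi_balanced_weighing_matrix v (q + q^2) (signed_matrix c)"
proof -
  define A where "A = adjacency_matrix v (symplectic_graph c)"
  have abs: "abs_mat (signed_matrix c) = A"
    by (simp add: abs_signed_matrix c A_def)
  have sym: "transpose_mat A = A"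
    unfolding A_def adjacency_symplectic_graph
    by (rule eq_matI) (auto simp: adjacent_commute)
  have "off_diagonal_entries (A * A) \<subseteq> {int (q - 1), int (q + 1)}"
    unfolding A_def adjacency_symplectic_graph_squared[OF c]
    unfolding off_diagonal_entries_def adjacency_symplectic_graph
    by (auto simp: all_ones_mat_def)
  hence "card (off_diagonal_entries (A * A)) \<le> card {int (q - 1), int (q + 1)}"
    by (intro card_mono) auto
  also have "\<dots> \<le> 2"
    by (simp add: card_insert_if)
  finally show ?thesis
    by (simp add: quasi_balanced_weighing_matrix_def weighing_signed_matrix c abs sym)
qed

section \<open>The spread lines as common cliques\<close>

text \<open>Unlike \<open>spread_graph\<close> this keeps the diagonal, to be an equivalence whose
  classes are the cliques.\<close>

definition spread_rel :: "(nat \<times> nat) set" where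
  "spread_rel = {(i, j). i < v \<and> j < v \<and> omega (h i) (h j) = 0}"

lemma equiv_spread_rel: "equiv {..<v} spread_rel"
proof (rule equivI)
  show "trans spread_rel"
  proof (rule transI)
    fix i j k assume "(i, j) \<in> spread_rel" "(j, k) \<in> spread_rel"
    hence *: "i < v" "j < v" "k < v" "omega (h i) (h j) = 0" "omega (h j) (h k) = 0"
      by (auto simp: spread_rel_def)
    \<comment> \<open>The vector \<open>h j\<close> is a nonzero K-multiple of \<open>h i\<close>,
      hence orthogonal to the same vectors under \<open>omega\<close>.\<close>
    define r where "r = ratio (h i) (h j)"
    have r: "scale r (h i) = h j"
      using * by (simp add: r_def scale_ratio h_point point_neq_0)
    hence "r * omega (h i) (h k) = 0"
      using *(5) by (metis omega_scale_left)
    moreover have "r \<noteq> 0"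
      using r * point_neq_0[OF h_point[of j]] by auto
    ultimately show "(i, k) \<in> spread_rel"
      using * by (simp add: spread_rel_def)
  qed
  show "sym spread_rel"
  proof (rule symI)
    show "(j, i) \<in> spread_rel" if "(i, j) \<in> spread_rel" for i j
      using that omega_commute[of "h j" "h i"] by (simp add: spread_rel_def)
  qed
qed (auto simp: refl_on_def spread_rel_def)

lemma card_spread_class:
  assumes "i < v"
  shows "card (spread_rel `` {i}) = 1 + q"
proof -
  have "bij_betw h (spread_rel `` {i}) {z\<in>points. omega (h i) z = 0}"
    unfolding bij_betw_def
  proof
    show "inj_on h (spread_rel `` {i})"
      using bij_h by (auto simp: bij_betw_def spread_rel_def intro: inj_on_subset)
    show "h ` (spread_rel `` {i}) = {z\<in>points. omega (h i) z = 0}"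
    proof (rule equalityI; rule subsetI)
      fix z assume z: "z \<in> {z\<in>points. omega (h i) z = 0}"
      then obtain j where "j < v" "z = h j"
        using bij_h by (auto simp: bij_betw_def)
      thus "z \<in> h ` (spread_rel `` {i})"
        using z assms by (auto simp: spread_rel_def)
    qed (auto simp: spread_rel_def h_point)
  qed
  thus ?thesis
    using card_points_line[OF point_neq_0[OF h_point[OF assms]]] by (simp add: bij_betw_same_card q_def)
qed

text \<open>The number of classes follows from their size and v = (1 + q)(1 + q^2).\<close>

lemma spread_graph_cliques: "disjoint_union_of_cliques v (1 + q^2) (1 + q) spread_graph"
  unfolding disjoint_union_of_cliques_def
proof (intro exI conjI)
  let ?P = "{..<v} // spread_rel"
  show part: "partition_on {..<v} ?P"
    by (rule partition_on_quotient[OF equiv_spread_rel])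
  show classes: "\<forall>C\<in>?P. card C = 1 + q"
    by (auto elim!: quotientE simp: card_spread_class)
  have "(1 + q) * card ?P = card (\<Union>?P)"
  proof (rule card_partition)
    show "finite ?P"
      using part finite_elements by blast
    show "finite (\<Union>?P)"
      using partition_onD1[OF part] by (metis finite_lessThan)
    show "C \<inter> D = {}" if "C \<in> ?P" "D \<in> ?P" "C \<noteq> D" for C D
      using partition_onD2[OF part] that by (auto simp: disjoint_def)
  qed (use classes in auto)
  also have "\<dots> = v"
    using partition_onD1[OF part] by (metis card_lessThan)
  also have "v = (1 + q) * (1 + q^2)"
    by (simp add: v_def q_def eval_nat_numeral)
  finally show "card ?P = 1 + q^2"
    by (metis mult_left_cancel add_is_0 zero_neq_one)
  show "spread_graph = (\<Union>C\<in>?P. complete_graph C)"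
  proof (rule equalityI; rule subsetI)
    fix e assume "e \<in> spread_graph"
    then obtain i j where e: "e = {i, j}" "i < v" "j < v" "i \<noteq> j" "omega (h i) (h j) = 0"
      by (auto simp: spread_graph_def edges_def)
    hence "e \<subseteq> spread_rel `` {i}" "card e = 2"
      by (auto simp: spread_rel_def)
    moreover have "spread_rel `` {i} \<in> ?P"
      using e by (simp add: quotientI)
    ultimately show "e \<in> (\<Union>C\<in>?P. complete_graph C)"
      by (auto simp: complete_graph_def)
  next
    fix e assume "e \<in> (\<Union>C\<in>?P. complete_graph C)"
    then obtain C where C: "C \<in> ?P" "e \<subseteq> C" "card e = 2"
      by (auto simp: complete_graph_def)
    then obtain i j where e: "e = {i, j}" "i \<noteq> j"
      by (auto simp: card_2_iff)
    hence "(i, j) \<in> spread_rel"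
      using C quotient_eq_iff[OF equiv_spread_rel C(1) C(1), of i j] by auto
    thus "e \<in> spread_graph"
      using e unfolding e(1) mem_spread_graph by (simp add: spread_rel_def)
  qed
qed

text \<open>Where \<open>omega\<close> vanishes, so does its multiple by every c.\<close>

lemma spread_graph_subset: "e \<in> spread_graph \<Longrightarrow> e \<in> symplectic_graph c"
  by (auto simp: spread_graph_def edges_def mem_symplectic_graph adjacent_def h_eq_iff)

lemma ex1_symplectic_graph:
  assumes "e \<in> complete_graph {..<v} - spread_graph"
  shows "\<exists>!d. e \<in> symplectic_graph (direction d)"
proof -
  obtain i j where e: "e = {i, j}" "i < v" "j < v" "i \<noteq> j"
    using assms by (auto simp: complete_graph_def card_2_iff)
  hence "omega (h i) (h j) \<noteq> 0"
    using assms by (auto simp: mem_spread_graph)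
  moreover have "e \<in> symplectic_graph c \<longleftrightarrow> im (c * omega (h i) (h j)) = 0" for c
    unfolding e(1) mem_symplectic_graph adjacent_def using e h_eq_iff by simp
  ultimately show ?thesis
    using ex1_direction by simp
qed

end

text \<open>A predicate of the number q alone, so that a result about a field type can be
  transferred to a variable q.\<close>

definition siamese_decomposition :: "nat \<Rightarrow> bool" where
  "siamese_decomposition q \<longleftrightarrow> (let v = 1 + q + q^2 + q^3 in
     \<exists>(W :: nat \<Rightarrow> int mat) (\<Gamma> :: nat \<Rightarrow> nat set set) F.
       simple_graph v F \<and>
       disjoint_union_of_cliques v (1 + q^2) (1 + q) F \<and>
       (\<forall>l\<le>q. quasi_balanced_weighing_matrix v (q + q^2) (W l) \<and>
              strongly_regular_graph v (q + q^2) (q - 1) (q + 1) (\<Gamma> l) \<and>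
              abs_mat (W l) = adjacency_matrix v (\<Gamma> l)) \<and>
       (\<forall>e\<in>F. \<forall>l\<le>q. e \<in> \<Gamma> l) \<and>
       (\<forall>e\<in>complete_graph {..<v} - F. \<exists>!l. l \<le> q \<and> e \<in> \<Gamma> l))"

theorem siamese_decomposition_paley_field: "siamese_decomposition CARD('a :: paley_field)"
proof -
  let ?q = "CARD('a)"
  let ?v = "1 + ?q + ?q^2 + ?q^3"
  obtain h :: "nat \<Rightarrow> 'a vec4" where h: "bij_betw h {..<?v} points"
    using card_points[where ?'a = 'a] ex_bij_betw_nat_finite[OF finite, of points]
    by (metis atLeast0LessThan)
  interpret point_enumeration h ?q ?v
    by standard (use h in simp_all)
  \<comment> \<open>The directions are numbered by 0, ..., q to index the graphs.\<close>
  have "CARD('a option) = ?q + 1"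
    by (simp add: card_UNIV_option)
  then obtain d :: "nat \<Rightarrow> 'a option" where d: "bij_betw d {..?q} UNIV"
    using ex_bij_betw_nat_finite[OF finite, of "UNIV :: 'a option set"]
    by (auto simp: atLeast0LessThan lessThan_Suc_atMost)
  have "\<exists>!l. l \<le> ?q \<and> P (d l)" if "\<exists>!s. P s" for P
    using that d by (auto simp: bij_betw_def inj_on_def) (metis UNIV_I atMost_iff image_iff)
  note * = this[OF ex1_symplectic_graph]
  show ?thesis
    unfolding siamese_decomposition_def Let_def
  proof (intro exI conjI)
    show "simple_graph ?v (spread_graph)"
      unfolding spread_graph_def by (rule simple_graph_edges) simp
    show "\<forall>l\<le>?q. quasi_balanced_weighing_matrix ?v (?q + ?q^2) (signed_matrix (direction (d l))) \<and>
        strongly_regular_graph ?v (?q + ?q^2) (?q - 1) (?q + 1) (symplectic_graph (direction (d l))) \<and>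
        abs_mat (signed_matrix (direction (d l))) =
          adjacency_matrix ?v (symplectic_graph (direction (d l)))"
      by (intro allI impI conjI quasi_balanced_signed_matrix abs_signed_matrix
          strongly_regular_symplectic_graph direction_neq_0)
    show "disjoint_union_of_cliques ?v (1 + ?q^2) (1 + ?q) (spread_graph)"
      by (rule spread_graph_cliques)
    show "\<forall>e\<in>spread_graph. \<forall>l\<le>?q. e \<in> symplectic_graph (direction (d l))"
      by (intro ballI allI impI spread_graph_subset)
    show "\<forall>e\<in>complete_graph {..<?v} - spread_graph. \<exists>!l. l \<le> ?q \<and> e \<in> symplectic_graph (direction (d l))"
      using * by blast
  qed
qed

section \<open>Finite fields as fixed points of the Frobenius map\<close>

text \<open>The polynomial X^q - X has derivative -1, so its q roots in the algebraically closed
  field are distinct.\<close>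

lemma card_roots_power_eq_self:
  assumes "prime CHAR('a :: alg_closed_field)" and "n > 0" and q: "q = CHAR('a) ^ n"
  shows "card {x :: 'a. x ^ q = x} = q"
proof -
  define P :: "'a poly" where "P = Polynomial.monom 1 q - Polynomial.monom 1 1"
  have q1: "q > 1"
    using assms prime_gt_1_nat one_less_power by blast
  have "Polynomial.degree (Polynomial.monom (1 :: 'a) q + - Polynomial.monom 1 1) = q"
    using q1 by (subst Polynomial.degree_add_eq_left) (auto simp: Polynomial.degree_monom_eq)
  hence deg: "Polynomial.degree P = q"
    by (simp add: P_def)
  have P0: "P \<noteq> 0"
    using deg q1 by auto
  have poly_P: "poly P x = x ^ q - x" for x
    by (simp add: P_def poly_monom)
  have "CHAR('a) dvd q"
    using q \<open>n > 0\<close> by auto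
  hence "of_nat q = (0 :: 'a)"
    using of_nat_eq_0_iff_char_dvd by blast
  hence pderiv_P: "poly (pderiv P) x = -1" for x
    by (simp add: P_def pderiv_diff pderiv_monom poly_monom)
  \<comment> \<open>A multiple root would also be a root of the derivative.\<close>
  have order_le: "Polynomial.order a P \<le> 1" for a
  proof (rule ccontr)
    assume "\<not> Polynomial.order a P \<le> 1"
    hence "[:-a, 1:] ^ 2 dvd P"
      using P0 by (simp add: order_divides)
    then obtain R where "P = [:-a, 1:] ^ 2 * R" ..
    hence "P = [:-a, 1:] * ([:-a, 1:] * R)"
      by (simp only: power2_eq_square mult.assoc)
    hence "poly (pderiv P) a = 0"
      by (simp only: pderiv_mult poly_add poly_mult) simp
    thus False
      by (simp add: pderiv_P)
  qed
  obtain A where A: "size A = q" "P = smult (Polynomial.lead_coeff P) (\<Prod>x\<in>#A. [:-x, 1:])"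
    using alg_closed_imp_factorization[OF P0] deg by auto
  have "proots P = proots (\<Prod>x\<in>#A. [:-x, 1:])"
    using P0 by (subst A(2)) (simp add: proots_smult)
  also have "\<dots> = A"
  proof (induction A)
    case (add x A)
    have "(\<Prod>x\<in>#A. [:-x, 1:]) \<noteq> 0"
      by (auto simp: prod_mset_zero_iff)
    with add show ?case
      by (simp add: proots_mult del: mult_pCons_left)
  qed simp
  finally have "size (proots P) = q"
    using A(1) by simp
  moreover have "proots P = mset_set {x. poly P x = 0}"
  proof (rule multiset_eqI)
    fix a
    show "count (proots P) a = count (mset_set {x. poly P x = 0}) a"
      using order_le[of a] P0 poly_roots_finite[OF P0] order_root[of P a]
      by (cases "poly P a = 0") (auto simp: order_0I)
  qed
  ultimately show ?thesis
    by (simp add: poly_P)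
qed

text \<open>HOL has no type depending on \<open>q\<close>, so a finite field of order \<open>q\<close> is not available as a
  type for a variable \<open>q\<close>. The type is only needed for a single closed term: a counterexample to
  the theorem if there is one, and 3 otherwise.\<close>

definition critical_q :: nat where
  "critical_q = (if \<exists>q. primepow q \<and> q mod 4 = 3 \<and> \<not> siamese_decomposition q
     then SOME q. primepow q \<and> q mod 4 = 3 \<and> \<not> siamese_decomposition q else 3)"

text \<open>The default 3 is a prime power congruent to 3 mod 4, so the first two facts hold in both
  cases. For the third, if \<open>critical_q\<close> is no counterexample, there is none.\<close>

lemma critical_q:
  shows primepow_critical_q: "primepow critical_q"
    and critical_q_mod_4: "critical_q mod 4 = 3"
    and siamese_if_critical: "\<lbrakk>siamese_decomposition critical_q; primepow q; q mod 4 = 3\<rbrakk>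
      \<Longrightarrow> siamese_decomposition q"
proof -
  let ?C = "\<lambda>q. primepow q \<and> q mod 4 = 3 \<and> \<not> siamese_decomposition q"
  have "primepow critical_q \<and> critical_q mod 4 = 3 \<and>
    (siamese_decomposition critical_q \<longrightarrow> (\<forall>q. \<not> ?C q))"
  proof (cases "\<exists>q. ?C q")
    case True
    hence "?C (SOME q. ?C q)"
      by (rule someI_ex)
    with True show ?thesis
      by (simp add: critical_q_def)
  next
    case False
    thus ?thesis
      unfolding critical_q_def by (simp only: if_False) simp
  qed
  thus "primepow critical_q" "critical_q mod 4 = 3"
    "\<lbrakk>siamese_decomposition critical_q; primepow q; q mod 4 = 3\<rbrakk> \<Longrightarrow> siamese_decomposition q"
    by blast+
qed

lemma critical_q_decomp:
  obtains k where "prime (aprimedivisor critical_q)" "k > 0" "critical_q = aprimedivisor critical_q ^ k"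
  using primepow_critical_q unfolding primepow_def
  by (metis aprimedivisor_prime_power)

section \<open>The field of order \<open>critical_q\<close>\<close>

text \<open>A type whose cardinality is the prime p below \<open>critical_q\<close>, so that
  \<open>mod_ring\<close> over it is the prime field.\<close>

typedef critical_index = "{..<aprimedivisor critical_q}"
  using primepow_critical_q by (intro exI[of _ 0]) (simp add: aprimedivisor_gt_0_nat primepow_gt_Suc_0)

lemma card_critical_index: "CARD(critical_index) = aprimedivisor critical_q"
  using type_definition.card[OF type_definition_critical_index] by simp

instance critical_index :: prime_card
proof
  show "prime CARD(critical_index)"
    using critical_q_decomp by (metis card_critical_index)
qed

typedef critical_field =
  "{x :: critical_index mod_ring alg_closure. x ^ critical_q = x}"
  by (intro exI[of _ 1]) simp

setup_lifting type_definition_critical_field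

lemma critical_q_power_of_CHAR:
  obtains n where "n > 0" "critical_q = CHAR(critical_index mod_ring alg_closure) ^ n"
proof -
  obtain k where "k > 0" "critical_q = aprimedivisor critical_q ^ k"
    by (rule critical_q_decomp)
  thus ?thesis
    by (intro that[of k]) (simp_all only: CHAR_alg_closure semiring_char_mod_ring card_critical_index)
qed

lemma prime_CHAR_critical: "prime CHAR(critical_index mod_ring alg_closure)"
  using prime_card[where ?'a = critical_index] by simp

lemma power_critical_q_add:
  fixes x y :: "critical_index mod_ring alg_closure"
  shows "(x + y) ^ critical_q = x ^ critical_q + y ^ critical_q"
proof -
  obtain n where "critical_q = CHAR(critical_index mod_ring alg_closure) ^ n"
    using critical_q_power_of_CHAR by blast
  thus ?thesis
    by (rule freshmans_dream'[OF prime_CHAR_critical])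
qed

lemma critical_q_odd: "odd critical_q"
  using critical_q_mod_4 by presburger

text \<open>The fixed points are closed under addition because \<open>critical_q\<close> is a power
  of the characteristic, and under negation because it is odd.\<close>

instantiation critical_field :: Fields.field
begin

lift_definition zero_critical_field :: critical_field is 0
  using critical_q_odd by (auto intro!: zero_power odd_pos)
lift_definition one_critical_field :: critical_field is 1
  by simp
lift_definition uminus_critical_field :: "critical_field \<Rightarrow> critical_field" is uminus
  by (simp add: critical_q_odd)
lift_definition plus_critical_field :: "critical_field \<Rightarrow> critical_field \<Rightarrow> critical_field" is "(+)"
  by (simp add: power_critical_q_add)
lift_definition minus_critical_field :: "critical_field \<Rightarrow> critical_field \<Rightarrow> critical_field" is "(-)"
  by (simp add: power_critical_q_add critical_q_odd flip: add_uminus_conv_diff)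
lift_definition times_critical_field :: "critical_field \<Rightarrow> critical_field \<Rightarrow> critical_field" is "(*)"
  by (simp add: power_mult_distrib)
lift_definition inverse_critical_field :: "critical_field \<Rightarrow> critical_field" is inverse
  by (simp add: power_inverse)
lift_definition divide_critical_field :: "critical_field \<Rightarrow> critical_field \<Rightarrow> critical_field" is "(/)"
  by (simp add: power_divide)

instance
proof
  fix a b c :: critical_field
  show "a * b * c = a * (b * c)" by transfer (rule mult.assoc)
  show "a * b = b * a" by transfer (rule mult.commute)
  show "1 * a = a" by transfer (rule mult_1_left)
  show "a + b + c = a + (b + c)" by transfer (rule add.assoc)
  show "a + b = b + a" by transfer (rule add.commute)
  show "0 + a = a" by transfer (rule add_0_left)
  show "- a + a = 0" by transfer (rule left_minus)
  show "a - b = a + - b" by transfer (rule diff_conv_add_uminus)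
  show "(a + b) * c = a * c + b * c" by transfer (rule distrib_right)
  show "(0 :: critical_field) \<noteq> 1" by transfer (rule zero_neq_one)
  show "inverse a * a = 1" if "a \<noteq> 0" using that by transfer (rule left_inverse)
  show "a div b = a * inverse b" by transfer (rule divide_inverse)
  show "inverse 0 = (0 :: critical_field)" by transfer (rule inverse_zero)
qed

end

lemma card_critical_field: "CARD(critical_field) = critical_q"
proof -
  obtain n where "n > 0" "critical_q = CHAR(critical_index mod_ring alg_closure) ^ n"
    using critical_q_power_of_CHAR by blast
  thus ?thesis
    using type_definition.card[OF type_definition_critical_field]
      card_roots_power_eq_self[OF prime_CHAR_critical] by simp
qed

instance critical_field :: finite_field
proof
  show "finite (UNIV :: critical_field set)"
    using card_critical_field critical_q_odd by (intro card_ge_0_finite) (auto intro: odd_pos)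
qed

instance critical_field :: paley_field
  by standard (simp add: card_critical_field critical_q_mod_4)

theorem theorem3p1:
  fixes q v :: nat
  assumes "primepow q"
    and "[int q = - 1] (mod 4)"
    and "v = 1 + q + q^2 + q^3"
  shows "(\<exists>W \<Gamma>. quasi_balanced_weighing_matrix v (q + q^2) W \<and>
             strongly_regular_graph v (q + q^2) (q - 1) (q + 1) \<Gamma> \<and>
             abs_mat W = adjacency_matrix v \<Gamma>) \<and>
         (\<exists>(W :: nat \<Rightarrow> int mat) (\<Gamma> :: nat \<Rightarrow> nat set set) F.
             simple_graph v F \<and>
             disjoint_union_of_cliques v (1 + q^2) (1 + q) F \<and>
             (\<forall>l\<le>q. quasi_balanced_weighing_matrix v (q + q^2) (W l) \<and>
                    strongly_regular_graph v (q + q^2) (q - 1) (q + 1) (\<Gamma> l) \<and>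
                    abs_mat (W l) = adjacency_matrix v (\<Gamma> l)) \<and>
             (\<forall>e\<in>F. \<forall>l\<le>q. e \<in> \<Gamma> l) \<and>
             (\<forall>e\<in>complete_graph {..<v} - F. \<exists>!l. l \<le> q \<and> e \<in> \<Gamma> l))"
proof -
  have "q mod 4 = 3"
  proof -
    have "int q mod 4 = 3"
      using assms(2) by (simp add: cong_def)
    thus ?thesis
      by presburger
  qed
  have "siamese_decomposition critical_q"
    using siamese_decomposition_paley_field[where ?'a = critical_field]
    by (simp only: card_critical_field)
  hence "siamese_decomposition q"
    using assms(1) \<open>q mod 4 = 3\<close> by (rule siamese_if_critical)
  \<comment> \<open>The first claim is the member l = 0 of the decomposition.\<close>
  thus ?thesis
    unfolding siamese_decomposition_def Let_def assms(3)[symmetric]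
    by (intro conjI) (assumption | (elim exE conjE, meson le0))+
qed

end
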